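(* Let $l\geq 2$, and let $H$ be a hypergraph with $n$ vertices and $n'<n$ an integer such that: (1) $H$ is $(2l+2)$-modest; (2) the number of red vertices of $H$ is $<n'$; (3) every vertex set of cardinality $\geq n'$ includes a hyperedge; (4) for every nonempty vertex set $X$ of cardinality $<n'$ there exist a vertex $x\in X$ and distinct hyperedges $h_1,h_2$ with $h_1\cap X=h_2\cap X=\{x\}$. Then the green sub-hypergraph of $H$ is an odd, $l$-meager hypergraph with more than $n-n'$ vertices.
   Context: A hypergraph is a pair $H=(U,T)$ with $U$ a finite nonempty vertex set and $T$ a collection of 3-element subsets of $U$ (hyperedges). For nonempty $X\subseteq U$, $\|X\|$ is its cardinality, $[X]$ is the number of hyperedges contained in $X$, and the sub-hypergraph $H|X=(X,\{h\in T: h\subseteq X\})$. $X$ is dense if $\|X\|\le2[X]$, super-dense if $\|X\|<2[X]$; a minimal dense set is a dense set with no proper nonempty dense subset. $H$ is $m$-meager if it has no dense vertex sets of cardinality $\le2m$, and $m$-modest if it has no super-dense vertex sets of cardinality $\le 2m$. $H$ is odd if for every nonempty vertex set $X$ there is a hyperedge $h$ with $\|h\cap X\|$ odd. With respect to $l$: a red block is a minimal dense vertex set of cardinality $\le2l$; a vertex is red if it belongs to a red block and green otherwise; the green sub-hypergraph is $H|G$ where $G$ is the set of green vertices. *)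

theory Defs
  imports Main
begin

type_synonym 'a hypergraph = "'a set \<times> 'a set set"

definition hypergraph :: "'a hypergraph \<Rightarrow> bool" where
  "hypergraph H \<longleftrightarrow> finite (fst H) \<and> fst H \<noteq> {} \<and> (\<forall>h\<in>snd H. h \<subseteq> fst H \<and> card h = 3)"

definition num_edges :: "'a hypergraph \<Rightarrow> 'a set \<Rightarrow> nat" where
  "num_edges H X = card {h \<in> snd H. h \<subseteq> X}"

definition sub_hypergraph :: "'a hypergraph \<Rightarrow> 'a set \<Rightarrow> 'a hypergraph" where
  "sub_hypergraph H X = (X, {h \<in> snd H. h \<subseteq> X})"

definition dense_set :: "'a hypergraph \<Rightarrow> 'a set \<Rightarrow> bool" where
  "dense_set H X \<longleftrightarrow> X \<subseteq> fst H \<and> X \<noteq> {} \<and> card X \<le> 2 * num_edges H X"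

definition super_dense_set :: "'a hypergraph \<Rightarrow> 'a set \<Rightarrow> bool" where
  "super_dense_set H X \<longleftrightarrow> X \<subseteq> fst H \<and> X \<noteq> {} \<and> card X < 2 * num_edges H X"

definition minimal_dense_set :: "'a hypergraph \<Rightarrow> 'a set \<Rightarrow> bool" where
  "minimal_dense_set H X \<longleftrightarrow> dense_set H X \<and> \<not> (\<exists>Y. Y \<subset> X \<and> Y \<noteq> {} \<and> dense_set H Y)"

definition meager :: "nat \<Rightarrow> 'a hypergraph \<Rightarrow> bool" where
  "meager m H \<longleftrightarrow> \<not> (\<exists>X. dense_set H X \<and> card X \<le> 2 * m)"

definition modest :: "nat \<Rightarrow> 'a hypergraph \<Rightarrow> bool" where
  "modest m H \<longleftrightarrow> \<not> (\<exists>X. super_dense_set H X \<and> card X \<le> 2 * m)"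

definition odd_hypergraph :: "'a hypergraph \<Rightarrow> bool" where
  "odd_hypergraph H \<longleftrightarrow>
     (\<forall>X. X \<subseteq> fst H \<and> X \<noteq> {} \<longrightarrow> (\<exists>h\<in>snd H. odd (card (h \<inter> X))))"

definition red_block :: "nat \<Rightarrow> 'a hypergraph \<Rightarrow> 'a set \<Rightarrow> bool" where
  "red_block l H X \<longleftrightarrow> minimal_dense_set H X \<and> card X \<le> 2 * l"

definition red_vertices :: "nat \<Rightarrow> 'a hypergraph \<Rightarrow> 'a set" where
  "red_vertices l H = {x \<in> fst H. \<exists>X. red_block l H X \<and> x \<in> X}"

definition green_vertices :: "nat \<Rightarrow> 'a hypergraph \<Rightarrow> 'a set" where
  "green_vertices l H = fst H - red_vertices l H"

definition green_sub_hypergraph :: "nat \<Rightarrow> 'a hypergraph \<Rightarrow> 'a hypergraph" where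
  "green_sub_hypergraph l H = sub_hypergraph H (green_vertices l H)"

end

(*
  For a set X of fewer than n' green vertices, hypothesis (4) gives x in X and two hyperedges meeting
  X only in x. If both left the green vertices, each would meet a red block. The union D of these
  two blocks is dense: if the blocks differ and intersect, their intersection is not dense by
  minimality, so by supermodularity of X |-> 2[X] - ||X|| the union would even be super-dense.
  Adding the two hyperedges to D adds at most three vertices, giving a super-dense set
  of at most 4l + 3 vertices and contradicting modesty.
*)

theory Submission
  imports Defs
begin

lemma hypergraph_finite_edges: "hypergraph H \<Longrightarrow> finite (snd H)"
  unfolding hypergraph_def by (intro finite_subset[of "snd H" "Pow (fst H)"]) auto

lemma hypergraph_sub_hypergraph:
  assumes "hypergraph H" "X \<subseteq> fst H" "X \<noteq> {}"
  shows "hypergraph (sub_hypergraph H X)"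
  using assms finite_subset by (auto simp: hypergraph_def sub_hypergraph_def)

text \<open>The edges inside \<open>A\<close> and those inside \<open>B\<close> all lie inside
  \<open>A \<union> B\<close>, and those counted twice are exactly the edges inside
  \<open>A \<inter> B\<close>. Equality can fail because an edge inside the union may lie in neither
  set.\<close>

lemma num_edges_supermodular:
  assumes "hypergraph H"
  shows "num_edges H A + num_edges H B \<le> num_edges H (A \<union> B) + num_edges H (A \<inter> B)"
proof -
  let ?E = "\<lambda>X. {h \<in> snd H. h \<subseteq> X}"
  have fin: "finite (?E X)" for X
    using hypergraph_finite_edges[OF assms] by simp
  have "card (?E A) + card (?E B) = card (?E A \<union> ?E B) + card (?E A \<inter> ?E B)"
    by (rule card_Un_Int[OF fin fin])
  also have "?E A \<inter> ?E B = ?E (A \<inter> B)" by auto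
  also have "card (?E A \<union> ?E B) \<le> card (?E (A \<union> B))"
    by (rule card_mono[OF fin]) auto
  finally show ?thesis by (simp add: num_edges_def)
qed

lemma exists_minimal_dense_subset:
  assumes "finite X" "dense_set H X"
  shows "\<exists>Y\<subseteq>X. minimal_dense_set H Y"
  using assms
proof (induction X rule: finite_psubset_induct)
  case (psubset X)
  show ?case
  proof (cases "minimal_dense_set H X")
    case False
    then obtain Y where "Y \<subset> X" "dense_set H Y"
      using psubset.prems by (auto simp: minimal_dense_set_def)
    then show ?thesis using psubset.IH[of Y] by blast
  qed blast
qed

lemma dense_set_Un_minimal_dense:
  assumes H: "hypergraph H" and A: "minimal_dense_set H A" and B: "minimal_dense_set H B"
  shows "dense_set H (A \<union> B)"
proof (cases "A = B")
  case True
  then show ?thesis using A by (simp add: minimal_dense_set_def)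
next
  case False
  have dense: "dense_set H A" "dense_set H B"
    using A B by (auto simp: minimal_dense_set_def)
  then have sub: "A \<subseteq> fst H" "B \<subseteq> fst H" and ne: "A \<noteq> {}"
    by (auto simp: dense_set_def)
  then have fin: "finite A" "finite B"
    using H finite_subset by (auto simp: hypergraph_def)
  \<comment> \<open>A weak inequality covers disjoint blocks too, and it suffices since only density
    of the union is claimed.\<close>
  have "2 * num_edges H (A \<inter> B) \<le> card (A \<inter> B)"
  proof (cases "A \<inter> B = {}")
    case True
    have "h \<noteq> {}" if "h \<in> snd H" for h using H that by (auto simp: hypergraph_def)
    then have "{h \<in> snd H. h \<subseteq> A \<inter> B} = {}" using True by auto
    then have "num_edges H (A \<inter> B) = 0" by (simp only: num_edges_def card.empty)
    then show ?thesis by simp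
  next
    case False
    \<comment> \<open>The intersection is proper in at least one of the two sets, and minimality of
      that one excludes its density.\<close>
    have "A \<inter> B \<subset> A \<or> A \<inter> B \<subset> B" using \<open>A \<noteq> B\<close> by blast
    then have "\<not> dense_set H (A \<inter> B)"
      using A B False by (auto simp: minimal_dense_set_def)
    then show ?thesis using sub False by (auto simp: dense_set_def)
  qed
  moreover have "card A + card B = card (A \<union> B) + card (A \<inter> B)"
    by (rule card_Un_Int[OF fin])
  moreover have "card A \<le> 2 * num_edges H A" "card B \<le> 2 * num_edges H B"
    using dense by (auto simp: dense_set_def)
  ultimately have "card (A \<union> B) \<le> 2 * num_edges H (A \<union> B)"
    using num_edges_supermodular[OF H, of A B] by linarith
  then show ?thesis using sub ne by (auto simp: dense_set_def)
qed

text \<open>Besides the shared vertex \<open>x\<close>, each edge adds at most one vertex to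
  \<open>D\<close>, as it already meets \<open>D\<close>. So the cardinality grows by at most 3
  while twice the edge count grows by at least 4, which turns density into super-density.\<close>

lemma super_dense_set_Un_two_edges:
  assumes H: "hypergraph H" and D: "dense_set H D" and x: "x \<notin> D"
    and h1: "h1 \<in> snd H" "x \<in> h1" "h1 \<inter> D \<noteq> {}"
    and h2: "h2 \<in> snd H" "x \<in> h2" "h2 \<inter> D \<noteq> {}"
    and "h1 \<noteq> h2"
  shows "super_dense_set H (D \<union> h1 \<union> h2)" and "card (D \<union> h1 \<union> h2) \<le> card D + 3"
proof -
  let ?W = "D \<union> h1 \<union> h2"
  have sub: "?W \<subseteq> fst H" "D \<noteq> {}" and D_le: "card D \<le> 2 * num_edges H D"
    using H D h1 h2 by (auto simp: dense_set_def hypergraph_def)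
  then have finD: "finite D" using H finite_subset by (auto simp: hypergraph_def)
  \<comment> \<open>Here \<open>b\<close> is the third vertex of \<open>h\<close>, next to
    \<open>x\<close> and a vertex \<open>a\<close> of \<open>D\<close>; it may itself lie in
    \<open>D\<close>.\<close>
  have new_vertex: "\<exists>b. h \<subseteq> D \<union> {x, b}" if h: "h \<in> snd H" "x \<in> h" "h \<inter> D \<noteq> {}" for h
  proof -
    obtain a where a: "a \<in> h" "a \<in> D" using h by blast
    have "card h = 3" using H h by (auto simp: hypergraph_def)
    moreover have "card {x, a} = 2" using a x by (cases "x = a") auto
    ultimately have "card (h - {x, a}) = 1"
      using a h by (subst card_Diff_subset) auto
    then obtain b where "h - {x, a} = {b}" by (auto simp: card_1_singleton_iff)
    then show ?thesis using a by blast
  qed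
  obtain b1 b2 where "h1 \<subseteq> D \<union> {x, b1}" "h2 \<subseteq> D \<union> {x, b2}"
    using new_vertex h1 h2 by meson
  then have "?W \<subseteq> D \<union> {x, b1, b2}" by blast
  then have "card ?W \<le> card (D \<union> {x, b1, b2})"
    using finD by (intro card_mono) auto
  also have "\<dots> \<le> card D + card {x, b1, b2}" by (rule card_Un_le)
  also have "card {x, b1, b2} \<le> 3" by (simp add: card_insert_if)
  finally show card_W: "card ?W \<le> card D + 3" by simp
  have finE: "finite {h \<in> snd H. h \<subseteq> Y}" for Y
    using hypergraph_finite_edges[OF H] by simp
  \<comment> \<open>Both edges contain \<open>x\<close>, which is outside \<open>D\<close>, so
    neither was counted before.\<close>
  have "h1 \<notin> {h \<in> snd H. h \<subseteq> D}" "h2 \<notin> {h \<in> snd H. h \<subseteq> D}"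
    using x h1 h2 by auto
  then have "num_edges H D + 2 = card ({h1, h2} \<union> {h \<in> snd H. h \<subseteq> D})"
    using \<open>h1 \<noteq> h2\<close> finE[of D] by (simp add: num_edges_def)
  also have "\<dots> \<le> num_edges H ?W"
    unfolding num_edges_def using h1 h2 by (intro card_mono[OF finE]) auto
  finally show "super_dense_set H ?W"
    using card_W D_le sub by (auto simp: super_dense_set_def)
qed

text \<open>This places one of the two edges from hypothesis (4) in the green sub-hypergraph. Since
  \<open>x\<close> is green, it avoids the red blocks that the edges would meet if both left the
  green set.\<close>

lemma green_edge_of_two_edges:
  assumes H: "hypergraph H" and modest: "modest (2 * l + 2) H"
    and x: "x \<in> green_vertices l H"
    and h1: "h1 \<in> snd H" "x \<in> h1" and h2: "h2 \<in> snd H" "x \<in> h2"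
    and "h1 \<noteq> h2"
  shows "h1 \<subseteq> green_vertices l H \<or> h2 \<subseteq> green_vertices l H"
proof (rule ccontr)
  assume "\<not> ?thesis"
  moreover have "h1 \<subseteq> fst H" "h2 \<subseteq> fst H" using H h1 h2 by (auto simp: hypergraph_def)
  ultimately obtain B1 B2 where B: "red_block l H B1" "red_block l H B2"
      "h1 \<inter> B1 \<noteq> {}" "h2 \<inter> B2 \<noteq> {}"
    by (fastforce simp: green_vertices_def red_vertices_def)
  let ?D = "B1 \<union> B2"
  have "dense_set H ?D"
    using B dense_set_Un_minimal_dense[OF H] by (auto simp: red_block_def)
  moreover have "x \<notin> ?D"
    using x B by (auto simp: green_vertices_def red_vertices_def)
  moreover have "h1 \<inter> ?D \<noteq> {}" "h2 \<inter> ?D \<noteq> {}" using B by auto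
  ultimately have "super_dense_set H (?D \<union> h1 \<union> h2)" "card (?D \<union> h1 \<union> h2) \<le> card ?D + 3"
    using super_dense_set_Un_two_edges[OF H _ _ h1 _ h2 _ \<open>h1 \<noteq> h2\<close>] by blast+
  moreover have "card ?D \<le> 4 * l"
    using card_Un_le[of B1 B2] B by (auto simp: red_block_def)
  ultimately show False
    using modest unfolding modest_def by fastforce
qed

lemma meager_green_sub_hypergraph:
  assumes H: "hypergraph H"
  shows "meager l (green_sub_hypergraph l H)"
  unfolding meager_def
proof
  let ?G = "green_vertices l H"
  assume "\<exists>X. dense_set (green_sub_hypergraph l H) X \<and> card X \<le> 2 * l"
  then obtain X where X: "dense_set (green_sub_hypergraph l H) X" "card X \<le> 2 * l"
    by blast
  then have XG: "X \<subseteq> ?G" by (simp add: dense_set_def green_sub_hypergraph_def sub_hypergraph_def)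
  then have finX: "finite X"
    using H finite_subset[of X "fst H"] by (auto simp: hypergraph_def green_vertices_def)
  have "{h \<in> snd (sub_hypergraph H ?G). h \<subseteq> X} = {h \<in> snd H. h \<subseteq> X}"
    using XG by (auto simp: sub_hypergraph_def)
  then have "dense_set H X"
    using X XG by (auto simp: dense_set_def num_edges_def green_sub_hypergraph_def green_vertices_def)
  then obtain Y where Y: "Y \<subseteq> X" "minimal_dense_set H Y"
    using exists_minimal_dense_subset[OF finX] by blast
  then have "red_block l H Y"
    using X card_mono[OF finX Y(1)] by (simp add: red_block_def)
  moreover obtain y where "y \<in> Y"
    using Y by (auto simp: minimal_dense_set_def dense_set_def)
  ultimately show False
    using Y XG by (auto simp: green_vertices_def red_vertices_def)
qed

theorem theorem2p3p1:
  fixes H :: "'a hypergraph" and l n :: nat and n' :: int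
  assumes "l \<ge> 2"
    and "hypergraph H"
    and "card (fst H) = n"
    and "n' < int n"
    and "modest (2 * l + 2) H"
    and "int (card (red_vertices l H)) < n'"
    and "\<forall>X. X \<subseteq> fst H \<and> int (card X) \<ge> n' \<longrightarrow> (\<exists>h\<in>snd H. h \<subseteq> X)"
    and "\<forall>X. X \<subseteq> fst H \<and> X \<noteq> {} \<and> int (card X) < n' \<longrightarrow>
           (\<exists>x\<in>X. \<exists>h1\<in>snd H. \<exists>h2\<in>snd H. h1 \<noteq> h2 \<and> h1 \<inter> X = {x} \<and> h2 \<inter> X = {x})"
  shows "hypergraph (green_sub_hypergraph l H) \<and>
         odd_hypergraph (green_sub_hypergraph l H) \<and>
         meager l (green_sub_hypergraph l H) \<and>
         int (card (fst (green_sub_hypergraph l H))) > int n - n'"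
proof -
  let ?G = "green_vertices l H"
  have G: "fst (green_sub_hypergraph l H) = ?G" "snd (green_sub_hypergraph l H) = {h \<in> snd H. h \<subseteq> ?G}"
    by (simp_all add: green_sub_hypergraph_def sub_hypergraph_def)
  have red: "red_vertices l H \<subseteq> fst H" by (auto simp: red_vertices_def)
  have fin: "finite (fst H)" using assms(2) by (simp add: hypergraph_def)
  have "card ?G = n - card (red_vertices l H)"
    unfolding green_vertices_def using assms(3) card_Diff_subset[OF finite_subset[OF red fin] red]
    by simp
  then have card_G: "int (card ?G) > int n - n'"
    using assms(6) by linarith
  then have "?G \<noteq> {}" using assms(4) by auto
  then have hyper: "hypergraph (green_sub_hypergraph l H)"
    unfolding green_sub_hypergraph_def using assms(2)
    by (intro hypergraph_sub_hypergraph) (auto simp: green_vertices_def)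
  have "\<exists>h\<in>snd (green_sub_hypergraph l H). odd (card (h \<inter> X))" if X: "X \<subseteq> ?G" "X \<noteq> {}" for X
  proof (cases "int (card X) < n'")
    case True
    have "X \<subseteq> fst H" using X by (auto simp: green_vertices_def)
    then obtain x h1 h2 where h: "x \<in> X" "h1 \<in> snd H" "h2 \<in> snd H" "h1 \<noteq> h2"
        "h1 \<inter> X = {x}" "h2 \<inter> X = {x}"
      using assms(8) X True by meson
    then have "h1 \<subseteq> ?G \<or> h2 \<subseteq> ?G"
      using X by (intro green_edge_of_two_edges[OF assms(2,5), of x]) auto
    moreover have "odd (card (h1 \<inter> X))" "odd (card (h2 \<inter> X))" using h by simp_all
    ultimately show ?thesis using h unfolding G by blast
  next
    case False
    moreover have "X \<subseteq> fst H" using X by (auto simp: green_vertices_def)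
    ultimately obtain h where h: "h \<in> snd H" "h \<subseteq> X"
      using assms(7) by (meson not_less)
    then have "card (h \<inter> X) = 3"
      using assms(2) by (simp add: hypergraph_def Int_absorb2)
    then show ?thesis using h X unfolding G by (intro bexI[of _ h]) auto
  qed
  then have "odd_hypergraph (green_sub_hypergraph l H)"
    unfolding odd_hypergraph_def G(1) by blast
  then show ?thesis
    using hyper card_G meager_green_sub_hypergraph[OF assms(2)] unfolding G(1) by blast
qed

end
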